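(* Let $a\ge 2$ be an integer and let $X$ be either $E(R)$ or $E(G)$. Let $l\in\mathbb{Z}$, let $\varepsilon=(\varepsilon_i)_{i\ge l}$ and $\varepsilon'=(\varepsilon'_i)_{i\ge l}$ be elements of $X$, and put $x=\sum_{i=l}^\infty\varepsilon_i\alpha^i$, $y=\sum_{i=l}^\infty\varepsilon'_i\alpha^i$. Then $x=y$ if and only if the set $S(\varepsilon,\varepsilon')$ is finite. Moreover, when $x=y$, one has $S(\varepsilon,\varepsilon')\subset S_a$, where $$S_a=\{0,\ \pm\alpha,\ \pm\alpha^2,\ \pm(\alpha-\alpha^2),\ \pm(1+(a-1)\alpha^2),\ \pm(1+(a-2)\alpha^2),\ \pm(1-\alpha+(a-1)\alpha^2),\ \pm(1-2\alpha+a\alpha^2)\}.$$ Furthermore $$S_a=\bigcup_{(\varepsilon,\varepsilon')\in\Delta}S(\varepsilon,\varepsilon'),$$ where $\Delta$ is the set of pairs $\big((\varepsilon_i)_{i\ge l},(\varepsilon'_i)_{i\ge l}\big)\in X\times X$ (with $l\in\mathbb{Z}$) such that $\sum_{i=l}^\infty\varepsilon_i\alpha^i=\sum_{i=l}^\infty\varepsilon'_i\alpha^i$.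
   Context: Let $a\ge2$ be an integer and write $x^3-ax^2+x-1=(x-\beta)(x-\alpha)(x-\gamma)$ with $\beta>1$ real and $\alpha,\gamma\in\mathbb{C}\setminus\mathbb{R}$ complex conjugates, $|\alpha|<1$. $<_{lex}$ is the lexicographic order on finite words of equal length over $\{0,\dots,a-1\}$. $E(R)$ is the set of sequences $(a_n)_{n\in\mathbb{Z}}\in\{0,\dots,a-1\}^{\mathbb{Z}}$ for which there is $k\in\mathbb{Z}$ with $a_k>0$, $a_i=0$ for all $i<k$, and $a_ia_{i-1}a_{i-2}a_{i-3}<_{lex}(a-1)(a-1)01$ for all $i\ge k$. $E(G)$ is the set of those sequences in $E(R)$ which, with the same $k$, also satisfy $a_k<a$, $a_{k+1}a_k<_{lex}(a-1)(a-1)$ and $a_{k+2}a_{k+1}a_k<_{lex}(a-1)(a-1)0$. A sequence in $E(R)$ vanishing at all indices $n<l$ is identified with $(a_n)_{n\ge l}$. For $\varepsilon=(\varepsilon_i)_{i\ge l}$ and $\varepsilon'=(\varepsilon'_i)_{i\ge l}$, $$S(\varepsilon,\varepsilon')=\Big\{\alpha^{-k+2}\sum_{i=l}^k(\varepsilon_i-\varepsilon'_i)\alpha^i\ :\ k\ge l\Big\}.$$ *)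

theory Defs
  imports Complex_Main
begin

definition lex_less :: "int list \<Rightarrow> int list \<Rightarrow> bool"  (infix \<open><\<^sub>l\<^sub>e\<^sub>x\<close> 50)
  where "u <\<^sub>l\<^sub>e\<^sub>x v \<longleftrightarrow> (u, v) \<in> lex {(x, y). x < y}"

text \<open>
  \<open>R_admissible a k s\<close> says that \<open>k\<close> is the first index at which \<open>s\<close> is nonzero (so \<open>k\<close> is
  determined by \<open>s\<close>) and that \<open>s\<close> satisfies the digit condition defining \<open>E(R)\<close>.
\<close>

definition R_admissible :: "int \<Rightarrow> int \<Rightarrow> (int \<Rightarrow> int) \<Rightarrow> bool"
  where "R_admissible a k s \<longleftrightarrow>
    (\<forall>n. s n \<in> {0..a - 1}) \<and> s k > 0 \<and> (\<forall>i<k. s i = 0) \<and>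
    (\<forall>i\<ge>k. [s i, s (i - 1), s (i - 2), s (i - 3)] <\<^sub>l\<^sub>e\<^sub>x [a - 1, a - 1, 0, 1])"

definition E_R :: "int \<Rightarrow> (int \<Rightarrow> int) set"
  where "E_R a = {s. \<exists>k. R_admissible a k s}"

text \<open>The condition \<open>s k < a\<close> is implied by the digit range; it is kept as in the source.\<close>

definition E_G :: "int \<Rightarrow> (int \<Rightarrow> int) set"
  where "E_G a = {s. \<exists>k. R_admissible a k s \<and> s k < a \<and>
    [s (k + 1), s k] <\<^sub>l\<^sub>e\<^sub>x [a - 1, a - 1] \<and>
    [s (k + 2), s (k + 1), s k] <\<^sub>l\<^sub>e\<^sub>x [a - 1, a - 1, 0]}"

text \<open>
  The one-sided sequences \<open>(s\<^sub>i)\<close>, \<open>i \<ge> l\<close>, belonging to \<open>X\<close>, represented by their extensions by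
  zero. The index \<open>l\<close> need not be the first index with a nonzero digit.
\<close>

definition seqs_from :: "(int \<Rightarrow> int) set \<Rightarrow> int \<Rightarrow> (int \<Rightarrow> int) set"
  where "seqs_from X l = {s \<in> X. \<forall>n<l. s n = 0}"

definition expansion :: "complex \<Rightarrow> int \<Rightarrow> (int \<Rightarrow> int) \<Rightarrow> complex"
  where "expansion \<alpha> l s = (\<Sum>n. of_int (s (l + int n)) * \<alpha> powi (l + int n))"

definition S_set :: "complex \<Rightarrow> int \<Rightarrow> (int \<Rightarrow> int) \<Rightarrow> (int \<Rightarrow> int) \<Rightarrow> complex set"
  where "S_set \<alpha> l s t =
    {\<alpha> powi (- k + 2) * (\<Sum>i=l..k. (of_int (s i) - of_int (t i)) * \<alpha> powi i) | k. k \<ge> l}"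

definition pm :: "complex set \<Rightarrow> complex set"
  where "pm A = A \<union> uminus ` A"

definition S_a :: "int \<Rightarrow> complex \<Rightarrow> complex set"
  where "S_a a \<alpha> = pm {0, \<alpha>, \<alpha>^2, \<alpha> - \<alpha>^2,
    1 + (of_int a - 1) * \<alpha>^2, 1 + (of_int a - 2) * \<alpha>^2,
    1 - \<alpha> + (of_int a - 1) * \<alpha>^2, 1 - 2 * \<alpha> + of_int a * \<alpha>^2}"

text \<open>Each pair in \<open>\<Delta>\<close> carries its starting index \<open>l\<close> explicitly.\<close>

definition Delta :: "complex \<Rightarrow> (int \<Rightarrow> int) set \<Rightarrow> (int \<times> (int \<Rightarrow> int) \<times> (int \<Rightarrow> int)) set"
  where "Delta \<alpha> X = {(l, s, t). s \<in> seqs_from X l \<and> t \<in> seqs_from X l \<and>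
    expansion \<alpha> l s = expansion \<alpha> l t}"

end

theory Submission
  imports Defs
begin

text \<open>
  Write \<open>d = \<epsilon> - \<epsilon>'\<close>. The proof replaces the complex numbers in \<open>S(\<epsilon>, \<epsilon>')\<close> by a sequence of
  integers. The reciprocal polynomial of the minimal polynomial of \<open>\<alpha>\<close> is, up to sign,
  \<open>P(z) = z\<^sup>3 - z\<^sup>2 + a z - 1\<close>; dividing the series \<open>\<Sum> d\<^sub>k z\<^sup>-\<^sup>k\<close> by \<open>P\<close> gives, after a
  shift of the index, integer carries \<open>u\<^sub>k\<close>, zero far to the left, with
  \<open>d\<^sub>k = u\<^sub>k\<^sub>+\<^sub>2 - u\<^sub>k\<^sub>+\<^sub>1 + a u\<^sub>k - u\<^sub>k\<^sub>-\<^sub>1\<close>. The \<open>k\<close>-th element of \<open>S(\<epsilon>, \<epsilon>')\<close> is then a fixed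
  \<open>\<int>[\<alpha>]\<close>-valued linear function of \<open>(u\<^sub>k, u\<^sub>k\<^sub>+\<^sub>1, u\<^sub>k\<^sub>+\<^sub>2)\<close> (lemma \<open>S_set_eq_carry_values\<close>), and
  everything is read off from the carries.

  The three conditions \<open>x = y\<close>, \<open>u\<close> is bounded, and \<open>S(\<epsilon>, \<epsilon>')\<close> is finite are equivalent. If
  \<open>x = y\<close>, each partial sum is minus a tail, so the elements of \<open>S\<close> are bounded; as two roots
  \<open>1/\<alpha>\<close>, \<open>1/\<gamma>\<close> of \<open>P\<close> are non-real and the third, \<open>1/\<beta>\<close>, lies in \<open>(0, 1)\<close>, this bounds \<open>u\<close>
  (\<open>carry_bounded_if_values_bounded\<close>). If \<open>S\<close> is finite, the partial sums are a bounded
  sequence times a power of \<open>\<alpha>\<close> and tend to zero (\<open>expansions_eq_if_values_finite\<close>).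

  For bounded \<open>u\<close> a maximum principle applies, because the Laurent coefficients of \<open>1/P\<close> on the
  unit circle have a small absolute sum: \<open>|u\<^sub>k| \<le> 1\<close>, or \<open>|u\<^sub>k| \<le> 2\<close> when \<open>a = 2\<close>
  (\<open>abs_carry_le\<close>). The value \<open>2\<close> would force three consecutive digits \<open>1\<close>, which is not
  admissible (\<open>carry_neq_2\<close>). Of the \<open>27\<close> triples over \<open>{-1, 0, 1}\<close>, the
  digit bound \<open>|d\<^sub>k| \<le> a - 1\<close> excludes most of those that do not belong to an element of \<open>S\<^sub>a\<close>; the
  triples \<open>\<plusminus>(1, 1, 1)\<close> and \<open>\<plusminus>(1, 0, 0)\<close> survive locally, but each occurrence of one of them forces an
  earlier one (for \<open>(1, 0, 0)\<close> by the lexicographic condition), contradicting that \<open>u\<close> starts with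
  zeros. What remains is \<open>S\<^sub>a\<close> (\<open>carry_triple\<close>, \<open>carry_value_in_S_a\<close>).

  Conversely, all elements of \<open>S\<^sub>a\<close> occur already for one pair of sequences in \<open>E(G)\<close> and the
  same pair in the opposite order: it is obtained from an eventually periodic carry sequence that
  runs through all allowed triples up to sign (\<open>S_a_attained\<close>).
\<close>

section \<open>Carry sequences\<close>

text \<open>
  Up to a shift of the index, \<open>u\<close> is the quotient of \<open>d\<close> by the polynomial
  \<open>z\<^sup>3 - z\<^sup>2 + a z - 1\<close>. When \<open>d\<close> vanishes below \<open>l\<close>, the first carry that can be nonzero is
  \<open>u\<^sub>l\<^sub>+\<^sub>2 = d\<^sub>l\<close>.
\<close>

definition is_carry :: "int \<Rightarrow> int \<Rightarrow> (int \<Rightarrow> int) \<Rightarrow> (int \<Rightarrow> int) \<Rightarrow> bool"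
  where "is_carry a l d u \<longleftrightarrow> (\<forall>k\<le>l + 1. u k = 0) \<and>
    (\<forall>k. d k = u (k + 2) - u (k + 1) + a * u k - u (k - 1))"

text \<open>
  The carries from index \<open>l - 1\<close> on, the argument \<open>e\<close> being the sequence \<open>d\<close> shifted to start at \<open>l\<close>.
\<close>

fun carry_rec :: "int \<Rightarrow> (nat \<Rightarrow> int) \<Rightarrow> nat \<Rightarrow> int" where
  "carry_rec a e (Suc (Suc (Suc n))) =
     e n + carry_rec a e (Suc (Suc n)) - a * carry_rec a e (Suc n) + carry_rec a e n"
| "carry_rec a e n = 0"

lemma ex_is_carry:
  assumes "\<And>k. k < l \<Longrightarrow> d k = 0"
  shows "\<exists>u. is_carry a l d u"
proof
  define u where "u k = carry_rec a (\<lambda>n. d (l + int n)) (nat (k - l + 1))" for k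
  have small: "u k = 0" if "k \<le> l + 1" for k
  proof -
    have "nat (k - l + 1) \<in> {0, 1, 2}" using that by auto
    then show ?thesis by (auto simp: u_def numeral_2_eq_2)
  qed
  have "d k = u (k + 2) - u (k + 1) + a * u k - u (k - 1)" for k
  proof (cases "k < l")
    case True
    then show ?thesis using assms small by simp
  next
    case False
    then obtain n where k: "k = l + int n" using zle_iff_zadd by (metis not_less)
    have "nat (k + 2 - l + 1) = Suc (Suc (Suc n))" "nat (k + 1 - l + 1) = Suc (Suc n)"
      "nat (k - l + 1) = Suc n" "nat (k - 1 - l + 1) = n"
      by (simp_all add: k)
    then show ?thesis unfolding u_def by (simp add: k)
  qed
  then show "is_carry a l d u" by (simp add: is_carry_def small)
qed

text \<open>
  The element of \<open>S(\<epsilon>, \<epsilon>')\<close> that belongs to three consecutive carries, written in the basis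
  \<open>1, \<alpha>, \<alpha>\<^sup>2\<close> of \<open>\<int>[\<alpha>]\<close>.
\<close>

definition carry_value :: "int \<Rightarrow> complex \<Rightarrow> int \<Rightarrow> int \<Rightarrow> int \<Rightarrow> complex"
  where "carry_value a \<alpha> x y z = of_int x + of_int (y - x) * \<alpha> + of_int (z - y + a * x) * \<alpha>\<^sup>2"

section \<open>Bounded carries of admissible digit sequences\<close>

text \<open>
  Used for carry patterns that can only arise from an earlier copy of themselves.
\<close>

lemma int_descent:
  fixes k l c :: int
  assumes "c > 0" and step: "\<And>k. P k \<Longrightarrow> P (k - c)" and base: "\<And>k. k \<le> l \<Longrightarrow> \<not> P k"
  shows "\<not> P k"
proof
  assume "P k"
  have "P (k - c * int n)" for n
  proof (induction n)
    case 0 then show ?case using \<open>P k\<close> by simp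
  next
    case (Suc n)
    from step[OF this] show ?case by (simp add: algebra_simps)
  qed
  moreover have "k - c * int (nat (k - l)) \<le> l"
  proof (cases "k \<le> l")
    case False
    then have "1 * (k - l) \<le> c * (k - l)" using \<open>c > 0\<close> by (intro mult_right_mono) auto
    then show ?thesis using False by (simp add: algebra_simps)
  qed simp
  ultimately show False using base by blast
qed

text \<open>
  Two digit sequences with a bounded carry sequence. The lexicographic condition enters only through
  its consequence \<open>s_adm\<close>: two consecutive maximal digits are preceded by two zeros.
\<close>

locale bounded_carries =
  fixes a l :: int and s t u :: "int \<Rightarrow> int"
  assumes a_ge_2: "a \<ge> 2"
    and s_digit: "0 \<le> s i" "s i \<le> a - 1"
    and t_digit: "0 \<le> t i" "t i \<le> a - 1"
    and s_adm: "s i = a - 1 \<Longrightarrow> s (i - 1) = a - 1 \<Longrightarrow> s (i - 2) = 0 \<and> s (i - 3) = 0"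
    and t_adm: "t i = a - 1 \<Longrightarrow> t (i - 1) = a - 1 \<Longrightarrow> t (i - 2) = 0 \<and> t (i - 3) = 0"
    and is_carry: "is_carry a l (\<lambda>k. s k - t k) u"
    and u_bounded: "\<exists>B. \<forall>k. \<bar>u k\<bar> \<le> B"
begin

lemma carry: "s k - t k = u (k + 2) - u (k + 1) + a * u k - u (k - 1)"
  and u_start: "k \<le> l + 1 \<Longrightarrow> u k = 0"
  using is_carry by (auto simp: is_carry_def)

text \<open>
  Exchanging the two sequences changes the sign of the carries, so every statement about a positive
  carry has a mirror image.
\<close>

lemma swap: "bounded_carries a l t s (\<lambda>k. - u k)"
proof
  show "is_carry a l (\<lambda>k. t k - s k) (\<lambda>k. - u k)"
    using carry by (auto simp: is_carry_def u_start algebra_simps)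
  show "\<exists>B. \<forall>k. \<bar>- u k\<bar> \<le> B" using u_bounded by simp
qed (fact a_ge_2 s_digit t_digit s_adm t_adm)+

lemma diff_le: "s k - t k \<le> a - 1" and diff_ge: "- (a - 1) \<le> s k - t k"
  using s_digit[of k] t_digit[of k] by linarith+

lemma ex_extremal_carry:
  obtains M m where "\<And>k. - M \<le> u k" "\<And>k. u k \<le> M" "u m = M \<or> u m = - M"
proof -
  from u_bounded obtain B where B: "\<And>k. \<bar>u k\<bar> \<le> B" by blast
  have fin: "finite (range (\<lambda>k. \<bar>u k\<bar>))"
    by (rule finite_subset[of _ "{0..B}"]) (use B in auto)
  define M where "M = Max (range (\<lambda>k. \<bar>u k\<bar>))"
  have "M \<in> range (\<lambda>k. \<bar>u k\<bar>)" unfolding M_def using fin by (intro Max_in) auto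
  then obtain m where "\<bar>u m\<bar> = M" by auto
  moreover have "\<bar>u k\<bar> \<le> M" for k unfolding M_def using fin by (intro Max_ge) auto
  ultimately show thesis using that[of M m] by (smt (verit))
qed

text \<open>
  A maximum principle. Let \<open>M\<close> be the largest absolute value of a carry, attained at index \<open>m\<close>. A
  suitable integer combination of the relations between \<open>d\<close> and \<open>u\<close> around \<open>m\<close> isolates
  \<open>c u\<^sub>m\<close> with \<open>c\<close> much larger than the sum of the other coefficients, so the bound on the digits
  bounds \<open>M\<close>. The weights are the largest Laurent coefficients of
  \<open>1/(z\<^sup>3 - z\<^sup>2 + a z - 1)\<close> on the unit circle, scaled and rounded. For \<open>a \<ge> 4\<close> three terms suffice;
  for smaller \<open>a\<close> the roots are closer to the unit circle, the coefficients decay more slowly, and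
  more terms are needed.
\<close>

lemma abs_carry_le: "\<bar>u k\<bar> \<le> (if a = 2 then 2 else 1)"
proof -
  obtain M m where lo: "\<And>k. - M \<le> u k" and hi: "\<And>k. u k \<le> M" and m: "u m = M \<or> u m = - M"
    by (fact ex_extremal_carry)
  define d where "d i = s (m + i) - t (m + i)" for i
  define v where "v i = u (m + i)" for i
  have d: "d i = v (i + 2) - v (i + 1) + a * v i - v (i - 1)" for i
    using carry[of "m + i"] unfolding d_def v_def by (simp add: algebra_simps)
  have dhi: "d i \<le> a - 1" and dlo: "- (a - 1) \<le> d i" for i
    unfolding d_def by (fact diff_le diff_ge)+
  have vhi: "v i \<le> M" and vlo: "- M \<le> v i" for i
    unfolding v_def by (fact lo hi)+
  have v0: "v 0 = M \<or> v 0 = - M" using m by (simp add: v_def)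
  have "M \<ge> 0" using vhi[of 0] vlo[of 0] by linarith
  consider "a = 2" | "a = 3" | "a \<ge> 4" using a_ge_2 by linarith
  then have "M \<le> (if a = 2 then 2 else 1)"
  proof cases
    case 1
    have "2 * d (-3) + 4 * d (-2) + 6 * d (-1) + 10 * d 0 - d 1 - 6 * d 2 - d 3 + 3 * d 4 + 2 * d 5
      = 19 * v 0 - 2 * v (-4) - v 4 + v 6 + 2 * v 7"
      unfolding d 1 by simp
    then have "13 * M \<le> 35"
      using v0 dhi[of "-3"] dlo[of "-3"] dhi[of "-2"] dlo[of "-2"] dhi[of "-1"] dlo[of "-1"]
        dhi[of 0] dlo[of 0] dhi[of 1] dlo[of 1] dhi[of 2] dlo[of 2] dhi[of 3] dlo[of 3]
        dhi[of 4] dlo[of 4] dhi[of 5] dlo[of 5] vhi[of "-4"] vlo[of "-4"] vhi[of 4] vlo[of 4]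
        vhi[of 6] vlo[of 6] vhi[of 7] vlo[of 7] 1
      by (elim disjE) linarith+
    then show ?thesis using 1 by simp
  next
    case 2
    have "2 * d (-2) + 7 * d (-1) + 20 * d 0 + 2 * d 1 - 7 * d 2 - 3 * d 3
      = 53 * v 0 - 2 * v (-3) - v (-2) - v (-1) - 4 * v 4 - 3 * v 5"
      unfolding d 2 by simp
    then have "42 * M \<le> 82"
      using v0 dhi[of "-2"] dlo[of "-2"] dhi[of "-1"] dlo[of "-1"]
        dhi[of 0] dlo[of 0] dhi[of 1] dlo[of 1] dhi[of 2] dlo[of 2] dhi[of 3] dlo[of 3]
        vhi[of "-3"] vlo[of "-3"] vhi[of "-2"] vlo[of "-2"] vhi[of "-1"] vlo[of "-1"]
        vhi[of 4] vlo[of 4] vhi[of 5] vlo[of 5] 2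
      by (elim disjE) linarith+
    then show ?thesis using 2 by simp
  next
    case 3
    have id: "d (-1) + (a + 1) * d 0 + d 1
      = (a * a + a - 2) * v 0 - v (-2) - v (-1) + a * v 2 + v 3"
      unfolding d by (simp add: algebra_simps)
    define D E X where "D = (a + 1) * d 0" and "E = a * v 2" and "X = (a * a + a - 2) * v 0"
    define D' E' X' where "D' = (a + 1) * (a - 1)" and "E' = a * M" and "X' = (a * a + a - 2) * M"
    have absD: "\<bar>D\<bar> \<le> D'" and absE: "\<bar>E\<bar> \<le> E'"
      unfolding D_def E_def D'_def E'_def abs_mult
      by (rule mult_mono; use 3 dhi[of 0] dlo[of 0] vhi[of 2] vlo[of 2] in linarith)+
    have absX: "\<bar>X\<bar> = X'"
    proof -
      have "0 \<le> a * a" by simp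
      then have "\<bar>a * a + a - 2\<bar> = a * a + a - 2" using 3 by linarith
      moreover have "\<bar>v 0\<bar> = M" using v0 \<open>M \<ge> 0\<close> by auto
      ultimately show ?thesis by (simp add: X_def X'_def abs_mult)
    qed
    have "d (-1) + D + d 1 = X - v (-2) - v (-1) + E + v 3"
      using id by (simp add: D_def E_def X_def)
    then have "X \<le> D' + 2 * a - 2 + E' + 3 * M" "- X \<le> D' + 2 * a - 2 + E' + 3 * M"
      using dhi[of "-1"] dlo[of "-1"] dhi[of 1] dlo[of 1] vhi[of "-2"] vlo[of "-2"]
        vhi[of "-1"] vlo[of "-1"] vhi[of 3] vlo[of 3] abs_le_D1[OF absD] abs_le_D2[OF absD]
        abs_le_D1[OF absE] abs_le_D2[OF absE]
      by linarith+
    then have "X' \<le> D' + 2 * a - 2 + E' + 3 * M" using absX by linarith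
    then have main: "(a * a - 5) * M \<le> a * a + 2 * a - 3"
      by (simp add: D'_def E'_def X'_def algebra_simps)
    have aa: "4 * a \<le> a * a" using 3 by (intro mult_right_mono) auto
    show ?thesis
    proof (rule ccontr)
      assume "\<not> ?thesis"
      then have "2 \<le> M" using 3 by simp
      then have "(a * a - 5) * 2 \<le> (a * a - 5) * M"
        by (rule mult_left_mono; use \<open>2 \<le> M\<close> aa 3 in linarith)
      then have "(a * a - 5) * 2 \<le> a * a + 2 * a - 3" using main by (rule order_trans)
      then have "a * a \<le> 2 * a + 7" by (simp add: algebra_simps)
      then show False using aa 3 by linarith
    qed
  qed
  then show ?thesis using lo[of k] hi[of k] by linarith
qed

text \<open>
  Two adjacent carries \<open>2\<close> would need, within a few steps to the left or to the right, a carry of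
  absolute value greater than \<open>2\<close>.
\<close>

lemma two_carries_2_not_adjacent:
  assumes "a = 2" "u k = 2"
  shows "u (k + 1) \<noteq> 2"
proof
  assume k1: "u (k + 1) = 2"
  define v where "v i = u (k + i)" for i
  have hi: "v i \<le> 2" and lo: "- 2 \<le> v i" for i
    using abs_carry_le[of "k + i"] assms(1) by (auto simp: v_def)
  have le: "v (i + 2) - v (i + 1) + 2 * v i - v (i - 1) \<le> 1"
    and ge: "- 1 \<le> v (i + 2) - v (i + 1) + 2 * v i - v (i - 1)" for i
    using carry[of "k + i"] diff_le[of "k + i"] diff_ge[of "k + i"] assms(1)
    unfolding v_def by (simp_all add: algebra_simps)
  have v: "v 0 = 2" "v 1 = 2" by (simp_all add: v_def assms k1)
  have c0: "v (-1) - v 2 \<ge> 1" using le[of 0] v by simp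
  have c1: "v 2 - v 3 \<ge> 1" using le[of 1] v by simp
  have cm1: "2 * v (-1) - v (-2) \<le> 1" using le[of "-1"] v by simp
  have "v (-1) \<le> 1" using cm1 hi[of "-2"] by linarith
  moreover have "v (-1) \<noteq> 1"
  proof
    assume 1: "v (-1) = 1"
    have "2 * v (-2) \<le> v (-3)" using le[of "-2"] v 1 by simp
    then have "v (-2) = 1" "v (-3) = 2" using cm1 hi[of "-3"] 1 by linarith+
    then show False using le[of "-3"] hi[of "-4"] 1 by simp
  qed
  ultimately have "v (-1) = 0" "v 2 = -1" "v 3 = -2"
    using c0 c1 lo[of 3] by linarith+
  then show False using ge[of 2] ge[of 3] le[of 2] hi[of 5] v by simp
qed

text \<open>
  The carries around an entry \<open>2\<close> are forced to be \<open>0, 0, 1, 2, 1, -1\<close>, since any other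
  choice leads to a carry of absolute value greater than \<open>2\<close> or to two adjacent carries \<open>2\<close> or \<open>-2\<close>.
\<close>

lemma carry_2_forces_differences_1:
  assumes a: "a = 2" and k: "u k = 2"
  shows "s k - t k = 1" "s (k - 1) - t (k - 1) = 1" "s (k - 2) - t (k - 2) = 1"
proof -
  interpret swap: bounded_carries a l t s "\<lambda>k. - u k" by (fact swap)
  define v where "v i = u (k + i)" for i
  have hi: "v i \<le> 2" and lo: "- 2 \<le> v i" for i
    using abs_carry_le[of "k + i"] a by (auto simp: v_def)
  have adj: "v i \<noteq> 2 \<or> v (i + 1) \<noteq> 2" and adj': "v i \<noteq> - 2 \<or> v (i + 1) \<noteq> - 2" for i
    using two_carries_2_not_adjacent[OF a, of "k + i"]
      swap.two_carries_2_not_adjacent[OF a, of "k + i"]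
    by (auto simp: v_def algebra_simps)
  have d: "s (k + i) - t (k + i) = v (i + 2) - v (i + 1) + 2 * v i - v (i - 1)" for i
    using carry[of "k + i"] a unfolding v_def by (simp add: algebra_simps)
  have le: "v (i + 2) - v (i + 1) + 2 * v i - v (i - 1) \<le> 1"
    and ge: "- 1 \<le> v (i + 2) - v (i + 1) + 2 * v i - v (i - 1)" for i
    using d[of i] diff_le[of "k + i"] diff_ge[of "k + i"] a by simp_all
  have v0: "v 0 = 2" by (simp add: v_def k)
  have c0: "v (-1) + v 1 - v 2 \<ge> 3" using le[of 0] v0 by simp
  have v1: "v 1 \<le> 1" using adj[of 0] v0 hi[of 1] by simp
  have vm1: "v (-1) \<le> 1" using adj[of "-1"] v0 hi[of "-1"] by simp
  have "v 2 \<noteq> - 2"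
  proof
    assume 2: "v 2 = - 2"
    have 3: "v 3 \<ge> - 1" using adj'[of 2] 2 lo[of 3] by simp
    have "v 1 + v 3 - v 4 \<le> - 3" using ge[of 2] 2 by simp
    then have v: "v 1 = 0" "v 3 = - 1" "v 4 = 2"
      using 3 c0 2 vm1 hi[of 4] by linarith+
    then have "v 5 \<le> 1" using adj[of 4] hi[of 5] by simp
    then show False using le[of 4] v lo[of 6] by simp
  qed
  then have v: "v (-1) = 1" "v 1 = 1" "v 2 = - 1"
    using c0 v1 vm1 lo[of 2] by linarith+
  have cm2: "2 * v (-2) \<le> v (-3)" using le[of "-2"] v0 v by simp
  have "v (-2) \<ge> 0" using le[of "-1"] v0 v by simp
  moreover have "v (-2) \<noteq> 1" using le[of "-3"] cm2 hi[of "-3"] hi[of "-4"] v by auto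
  ultimately have vm2: "v (-2) = 0" using cm2 hi[of "-3"] by linarith
  have "v (-3) \<noteq> 2" using le[of "-3"] hi[of "-4"] v vm2 by auto
  moreover have "v (-3) \<noteq> 1"
  proof
    assume 1: "v (-3) = 1"
    then have "v (-4) = 2" using le[of "-3"] hi[of "-4"] v vm2 by simp
    moreover from this have "v (-5) = 2" using le[of "-4"] hi[of "-5"] v vm2 1 by simp
    ultimately show False using adj[of "-5"] by simp
  qed
  ultimately have "v (-3) = 0" using cm2 vm2 hi[of "-3"] by linarith
  then show "s k - t k = 1" "s (k - 1) - t (k - 1) = 1" "s (k - 2) - t (k - 2) = 1"
    using d[of 0] d[of "-1"] d[of "-2"] v0 v vm2 by simp_all
qed

lemma carry_neq_2: "u k \<noteq> 2"
proof
  assume k: "u k = 2"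
  then have a: "a = 2" using abs_carry_le[of k] by (auto split: if_splits)
  from carry_2_forces_differences_1[OF this k] have "s k = 1" "s (k - 1) = 1" "s (k - 2) = 1"
    using s_digit[of k] t_digit[of k] s_digit[of "k - 1"] t_digit[of "k - 1"]
      s_digit[of "k - 2"] t_digit[of "k - 2"] a by auto
  then show False using s_adm[of k] a by simp
qed

lemma carry_le_1: "u k \<le> 1"
  using abs_carry_le[of k] carry_neq_2[of k] by (auto split: if_splits)

text \<open>
  This is the digit bound \<open>d\<^sub>k \<le> a - 1\<close>; the large term \<open>a u\<^sub>k\<close> cancels, which leaves a condition
  that is the same for all \<open>a\<close>.
\<close>

lemma carries_around_1:
  assumes "u k = 1" shows "u (k - 1) + u (k + 1) - u (k + 2) \<ge> 1"
  using diff_le[of k] carry[of k] assms by simp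

text \<open>
  In \<open>(1, 1, 1)\<close> the bound at the first entry allows only a preceding carry \<open>1\<close>, so the ones would
  continue to the left forever.
\<close>

lemma no_carries_111: "\<not> (u k = 1 \<and> u (k + 1) = 1 \<and> u (k + 2) = 1)"
proof (rule int_descent[where c = 1 and l = l and P = "\<lambda>k. u k = 1 \<and> u (k + 1) = 1 \<and> u (k + 2) = 1"])
  fix k assume "u k = 1 \<and> u (k + 1) = 1 \<and> u (k + 2) = 1"
  then show "u (k - 1) = 1 \<and> u (k - 1 + 1) = 1 \<and> u (k - 1 + 2) = 1"
    using carries_around_1[of k] carry_le_1[of "k - 1"] by (simp add: algebra_simps)
qed (auto simp: u_start)

end

context bounded_carries
begin

interpretation swap: bounded_carries a l t s "\<lambda>k. - u k" by (fact swap)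

lemma carry_ge_m1: "- 1 \<le> u k"
  using swap.carry_le_1[of k] by simp

text \<open>
  The carries before \<open>(1, 0, 0)\<close> must be \<open>0, 1\<close>, with maximal digits \<open>a - 1\<close> at two consecutive
  places. Admissibility makes the two digits before them zero, and then the carries further to the left
  are \<open>1, 0, 0\<close> again, four places earlier.
\<close>

lemma no_carries_100: "\<not> (u k = 1 \<and> u (k + 1) = 0 \<and> u (k + 2) = 0)"
proof (rule int_descent[where c = 4 and l = l and P = "\<lambda>k. u k = 1 \<and> u (k + 1) = 0 \<and> u (k + 2) = 0"])
  fix k assume k: "u k = 1 \<and> u (k + 1) = 0 \<and> u (k + 2) = 0"
  have 1: "u (k - 1) = 1" using carries_around_1[of k] carry_le_1[of "k - 1"] k by simp
  have 2: "u (k - 2) = 0"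
    using carries_around_1[of "k - 1"] no_carries_111[of "k - 2"] carry_le_1[of "k - 2"] k 1
    by (simp add: algebra_simps)
  have "s k - t k = a - 1" "s (k - 1) - t (k - 1) = a - 1"
    using carry[of k] carry[of "k - 1"] k 1 2 by (simp_all add: algebra_simps)
  then have "s k = a - 1" "s (k - 1) = a - 1"
    using s_digit t_digit by (smt (verit))+
  then have s: "s (k - 2) = 0" "s (k - 3) = 0" using s_adm by auto
  then have "u (k - 3) \<ge> 0"
    using carry[of "k - 2"] t_digit[of "k - 2"] k 1 2 by simp
  moreover have "1 + a * u (k - 3) \<le> u (k - 4)"
    using carry[of "k - 3"] t_digit[of "k - 3"] k 1 2 s by simp
  moreover have "u (k - 3) = 0"
    using calculation carry_le_1[of "k - 4"] carry_le_1[of "k - 3"] a_ge_2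
    by (cases "u (k - 3) = 1") auto
  ultimately show "u (k - 4) = 1 \<and> u (k - 4 + 1) = 0 \<and> u (k - 4 + 2) = 0"
    using carry_le_1[of "k - 4"] carry_le_1[of "k - 3"] 2 by auto
qed (auto simp: u_start)

text \<open>
  Because \<open>u\<^sub>k\<^sub>-\<^sub>1 \<le> 1\<close>, the bound around a carry \<open>1\<close> says that the next two carries do not increase.
\<close>

lemma carries_after_1:
  assumes "u k = 1"
  shows "(u (k + 1), u (k + 2)) \<in> {(1, 0), (1, -1), (0, -1), (-1, -1)}"
proof -
  have "u (k + 2) \<le> u (k + 1)"
    using carries_around_1[OF assms] carry_le_1[of "k - 1"] by linarith
  moreover have "u (k + 1) \<in> {-1, 0, 1}" "u (k + 2) \<in> {-1, 0, 1}"
    using carry_le_1[of "k + 1"] carry_ge_m1[of "k + 1"]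
      carry_le_1[of "k + 2"] carry_ge_m1[of "k + 2"] by auto
  ultimately show ?thesis using no_carries_111[of k] no_carries_100[of k] assms by auto
qed

lemma carries_after_01:
  assumes "u k = 0" "u (k + 1) = 1"
  shows "u (k + 2) \<in> {0, 1}"
proof -
  have "u (k + 2) > u (k + 3)"
    using carries_around_1[OF assms(2)] assms(1) by (simp add: algebra_simps)
  then show ?thesis using carry_ge_m1[of "k + 3"] carry_le_1[of "k + 2"] by auto
qed

end

context bounded_carries
begin

interpretation swap: bounded_carries a l t s "\<lambda>k. - u k" by (fact swap)

text \<open>
  Up to sign, exactly the triples that correspond to the elements of \<open>S\<^sub>a\<close>.
\<close>

lemma carry_triple:
  "\<exists>\<sigma>\<in>{1, -1}. (\<sigma> * u k, \<sigma> * u (k + 1), \<sigma> * u (k + 2)) \<in>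
     {(0,0,0), (0,1,1), (0,0,1), (0,1,0), (1,1,0), (1,1,-1), (1,0,-1), (1,-1,-1)}"
proof -
  have range: "u i = 1 \<or> - u i = 1 \<or> u i = 0" for i
    using carry_le_1[of i] carry_ge_m1[of i] by auto
  consider "u k = 1" | "- u k = 1" | "u k = 0" "u (k + 1) = 1" | "u k = 0" "- u (k + 1) = 1"
    | "u k = 0" "u (k + 1) = 0"
    using range[of k] range[of "k + 1"] by blast
  then show ?thesis
  proof cases
    case 1
    then show ?thesis using carries_after_1[of k] by auto
  next
    case 2
    then show ?thesis using swap.carries_after_1[of k] by auto
  next
    case 3
    then show ?thesis using carries_after_01[of k] by auto
  next
    case 4
    then show ?thesis using swap.carries_after_01[of k] by auto
  next
    case 5
    then show ?thesis using range[of "k + 2"] by auto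
  qed
qed

lemma carry_value_in_S_a: "carry_value a \<alpha> (u k) (u (k + 1)) (u (k + 2)) \<in> S_a a \<alpha>"
proof -
  let ?T = "{(0,0,0), (0,1,1), (0,0,1), (0,1,0), (1,1,0), (1,1,-1), (1,0,-1), (1,-1,-1)}"
  let ?B = "{0, \<alpha>, \<alpha>^2, \<alpha> - \<alpha>^2,
    1 + (of_int a - 1) * \<alpha>^2, 1 + (of_int a - 2) * \<alpha>^2,
    1 - \<alpha> + (of_int a - 1) * \<alpha>^2, 1 - 2 * \<alpha> + of_int a * \<alpha>^2}"
  have base: "carry_value a \<alpha> x y z \<in> ?B" if "(x, y, z) \<in> ?T" for x y z
    using that by (auto simp: carry_value_def algebra_simps)
  have neg: "carry_value a \<alpha> (- x) (- y) (- z) = - carry_value a \<alpha> x y z" for x y z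
    by (simp add: carry_value_def algebra_simps)
  from carry_triple[of k] obtain \<sigma> where "\<sigma> = 1 \<or> \<sigma> = - 1"
    and T: "(\<sigma> * u k, \<sigma> * u (k + 1), \<sigma> * u (k + 2)) \<in> ?T" by blast
  then show ?thesis
  proof (elim disjE)
    assume "\<sigma> = - 1"
    with base[OF T] have "- carry_value a \<alpha> (u k) (u (k + 1)) (u (k + 2)) \<in> ?B"
      by (simp only: mult_minus1 neg)
    then show ?thesis unfolding S_a_def pm_def by (metis UnI2 image_eqI minus_minus)
  qed (use base[OF T] in \<open>simp add: S_a_def pm_def\<close>)
qed

end

section \<open>Carries and the conjugate root\<close>

text \<open>
  The hypotheses on \<open>\<alpha>\<close> in the form of Vieta's formulas: \<open>\<alpha>\<close>, \<open>cnj \<alpha>\<close> and \<open>\<beta>\<close> are the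
  roots of \<open>x\<^sup>3 - a x\<^sup>2 + x - 1\<close>.
\<close>

locale conjugate_root =
  fixes a :: int and \<alpha> :: complex and \<beta> :: real
  assumes vieta_sum: "\<alpha> + cnj \<alpha> + of_real \<beta> = of_int a"
    and vieta_pairs: "\<alpha> * cnj \<alpha> + of_real \<beta> * (\<alpha> + cnj \<alpha>) = 1"
    and vieta_prod: "of_real \<beta> * (\<alpha> * cnj \<alpha>) = 1"
    and not_real: "\<alpha> \<notin> \<real>"
    and norm_less_1: "norm \<alpha> < 1"
begin

lemma nonzero: "\<alpha> \<noteq> 0" and beta_nonzero: "\<beta> \<noteq> 0"
  using vieta_prod by auto

lemma alpha_cubed: "\<alpha> ^ 3 = of_int a * \<alpha>\<^sup>2 - \<alpha> + 1"
proof -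
  have "of_int a * \<alpha>\<^sup>2 - \<alpha> * (\<alpha> * cnj \<alpha> + of_real \<beta> * (\<alpha> + cnj \<alpha>)) +
      of_real \<beta> * (\<alpha> * cnj \<alpha>) = \<alpha> ^ 3"
    unfolding vieta_sum[symmetric] by algebra
  then show ?thesis by (simp add: vieta_pairs vieta_prod)
qed

text \<open>
  Passing from one element of \<open>S(\<epsilon>, \<epsilon>')\<close> to the next: divide by \<open>\<alpha>\<close>, which is a unit of
  \<open>\<int>[\<alpha>]\<close>, and add \<open>d \<alpha>\<^sup>2\<close> for the new digit.
\<close>

lemma carry_value_step:
  assumes "d = u3 - u2 + a * u1 - u0"
  shows "\<alpha> * carry_value a \<alpha> u1 u2 u3 = carry_value a \<alpha> u0 u1 u2 + of_int d * \<alpha> ^ 3"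
proof -
  have "\<alpha> * carry_value a \<alpha> u1 u2 u3 =
      of_int u1 * \<alpha> + of_int (u2 - u1) * \<alpha>\<^sup>2 + of_int u0 * \<alpha> ^ 3 + of_int d * \<alpha> ^ 3"
    unfolding carry_value_def assms by (simp add: algebra_simps power2_eq_square power3_eq_cube)
  also have "of_int u0 * \<alpha> ^ 3 = of_int u0 * (of_int a * \<alpha>\<^sup>2 - \<alpha> + 1)"
    by (simp add: alpha_cubed)
  finally show ?thesis unfolding carry_value_def by (simp add: algebra_simps)
qed

lemma partial_sum_eq_carry_value:
  assumes u: "is_carry a l d u"
  shows "(\<Sum>n\<le>N. of_int (d (l + int n)) * \<alpha> ^ n) * \<alpha>\<^sup>2 =
    \<alpha> ^ N * carry_value a \<alpha> (u (l + int N)) (u (l + int N + 1)) (u (l + int N + 2))"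
proof (induction N)
  case 0
  have "d l = u (l + 2)" and "u l = 0" "u (l + 1) = 0"
    using u unfolding is_carry_def by auto
  then show ?case by (simp add: carry_value_def)
next
  case (Suc N)
  let ?k = "l + int N"
  have "d (?k + 1) = u (?k + 3) - u (?k + 2) + a * u (?k + 1) - u ?k"
    using u unfolding is_carry_def by (auto dest!: spec[of _ "?k + 1"] simp: add.assoc)
  from carry_value_step[OF this]
  have step: "\<alpha> * carry_value a \<alpha> (u (?k + 1)) (u (?k + 2)) (u (?k + 3)) =
    carry_value a \<alpha> (u ?k) (u (?k + 1)) (u (?k + 2)) + of_int (d (?k + 1)) * \<alpha> ^ 3" .
  have "(\<Sum>n\<le>Suc N. of_int (d (l + int n)) * \<alpha> ^ n) * \<alpha>\<^sup>2 =
    \<alpha> ^ N * carry_value a \<alpha> (u ?k) (u (?k + 1)) (u (?k + 2)) + \<alpha> ^ N * (of_int (d (?k + 1)) * \<alpha> ^ 3)"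
    using Suc by (simp add: algebra_simps power2_eq_square power3_eq_cube)
  also have "\<dots> = \<alpha> ^ N * (\<alpha> * carry_value a \<alpha> (u (?k + 1)) (u (?k + 2)) (u (?k + 3)))"
    unfolding step by (simp only: distrib_left)
  finally show ?case by (simp add: algebra_simps)
qed

lemma powi_shift: "\<alpha> powi (l + int n) = \<alpha> powi l * \<alpha> ^ n"
  by (simp add: power_int_add nonzero)

lemma sum_int_interval:
  "(\<Sum>i=l..l + int N. g i) = (\<Sum>n\<le>N. g (l + int n) :: complex)"
  by (rule sum.reindex_bij_witness[where j = "\<lambda>i. nat (i - l)" and i = "\<lambda>n. l + int n"]) auto

lemma S_set_eq_carry_values:
  assumes u: "is_carry a l (\<lambda>k. s k - t k) u"
  shows "S_set \<alpha> l s t =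
    range (\<lambda>N. carry_value a \<alpha> (u (l + int N)) (u (l + int N + 1)) (u (l + int N + 2)))"
proof -
  have element: "\<alpha> powi (- (l + int N) + 2) * (\<Sum>i=l..l + int N. (of_int (s i) - of_int (t i)) * \<alpha> powi i)
    = carry_value a \<alpha> (u (l + int N)) (u (l + int N + 1)) (u (l + int N + 2))" for N
  proof -
    let ?Q = "\<Sum>n\<le>N. of_int (s (l + int n) - t (l + int n)) * \<alpha> ^ n"
    have sum: "(\<Sum>i=l..l + int N. (of_int (s i) - of_int (t i)) * \<alpha> powi i) = \<alpha> powi l * ?Q"
      unfolding sum_int_interval powi_shift sum_distrib_left
      by (simp add: algebra_simps)
    have "\<alpha> powi (- (l + int N) + 2) * \<alpha> powi l * \<alpha> powi (int N) =
        \<alpha> powi (- (l + int N) + 2 + l + int N)"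
      using nonzero by (simp only: power_int_add simp_thms)
    also have "- (l + int N) + 2 + l + int N = 2" by simp
    finally have pow: "\<alpha> powi (- (l + int N) + 2) * \<alpha> powi l * \<alpha> ^ N = \<alpha>\<^sup>2" by simp
    have "\<alpha> ^ N * (\<alpha> powi (- (l + int N) + 2) * (\<alpha> powi l * ?Q)) =
        ?Q * (\<alpha> powi (- (l + int N) + 2) * \<alpha> powi l * \<alpha> ^ N)"
      by (simp only: mult_ac)
    then have "\<alpha> ^ N * (\<alpha> powi (- (l + int N) + 2) *
        (\<Sum>i=l..l + int N. (of_int (s i) - of_int (t i)) * \<alpha> powi i)) = ?Q * \<alpha>\<^sup>2"
      by (simp only: sum pow)
    then show ?thesis
      using partial_sum_eq_carry_value[OF u, of N] nonzero by simp
  qed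
  have ints: "{k. k \<ge> l} = range (\<lambda>N. l + int N)"
    using zle_iff_zadd by auto
  show ?thesis unfolding S_set_def setcompr_eq_image ints image_image element ..
qed

lemma power_series_summable:
  assumes "\<And>n. \<bar>e n\<bar> \<le> (B :: int)"
  shows "summable (\<lambda>n. norm (of_int (e n) * \<alpha> ^ n))"
proof (rule summable_comparison_test')
  show "summable (\<lambda>n. of_int B * norm \<alpha> ^ n)"
    using norm_less_1 by (intro summable_mult summable_geometric) simp
  show "norm (norm (of_int (e n) * \<alpha> ^ n)) \<le> of_int B * norm \<alpha> ^ n" for n
    using assms[of n] by (auto simp: norm_mult norm_power intro!: mult_right_mono)
qed

lemma expansion_eq_iff:
  assumes "\<And>k. \<bar>s k\<bar> \<le> B" "\<And>k. \<bar>t k\<bar> \<le> B"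
  shows "expansion \<alpha> l s = expansion \<alpha> l t \<longleftrightarrow>
    (\<Sum>n. of_int (s (l + int n) - t (l + int n)) * \<alpha> ^ n) = 0"
proof -
  have sum: "summable (\<lambda>n. of_int (f (l + int n)) * \<alpha> ^ n)" if "\<And>k. \<bar>f k\<bar> \<le> B" for f :: "int \<Rightarrow> int"
    by (rule summable_norm_cancel, rule power_series_summable) (rule that)
  have ex: "expansion \<alpha> l f = \<alpha> powi l * (\<Sum>n. of_int (f (l + int n)) * \<alpha> ^ n)"
    if "\<And>k. \<bar>f k\<bar> \<le> B" for f :: "int \<Rightarrow> int"
    unfolding expansion_def powi_shift using suminf_mult[OF sum[OF that], of "\<alpha> powi l"]
    by (simp add: mult.left_commute)
  have "(\<Sum>n. of_int (s (l + int n) - t (l + int n)) * \<alpha> ^ n) =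
    (\<Sum>n. of_int (s (l + int n)) * \<alpha> ^ n) - (\<Sum>n. of_int (t (l + int n)) * \<alpha> ^ n)"
    by (subst suminf_diff[OF sum sum]) (use assms in \<open>auto simp: algebra_simps\<close>)
  then show ?thesis using ex[of s] ex[of t] assms nonzero by simp
qed

text \<open>
  A partial sum of a series with sum zero is minus the remaining tail.
\<close>

lemma partial_sum_bound:
  assumes B: "\<And>n. \<bar>e n\<bar> \<le> (B :: int)" and zero: "(\<Sum>n. of_int (e n) * \<alpha> ^ n) = 0"
  shows "norm (\<Sum>n\<le>N. of_int (e n) * \<alpha> ^ n) \<le> of_int B / (1 - norm \<alpha>) * norm \<alpha> ^ N"
proof -
  let ?f = "\<lambda>n. of_int (e n) * \<alpha> ^ n"
  have sum: "summable (\<lambda>n. norm (?f n))" by (rule power_series_summable) (rule B)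
  have "B \<ge> 0" using B[of 0] by linarith
  have "(\<Sum>n\<le>N. ?f n) = - (\<Sum>n. ?f (n + Suc N))"
    using suminf_minus_initial_segment[OF summable_norm_cancel[OF sum], of "Suc N"] zero
    by (simp add: lessThan_Suc_atMost)
  then have "norm (\<Sum>n\<le>N. ?f n) = norm (\<Sum>n. ?f (n + Suc N))" by simp
  also have "\<dots> \<le> (\<Sum>n. norm (?f (n + Suc N)))"
    using sum by (intro summable_norm) (subst summable_iff_shift, assumption)
  also have "\<dots> \<le> (\<Sum>n. of_int B * norm \<alpha> ^ N * norm \<alpha> ^ n)"
  proof (rule suminf_le)
    fix n
    have "norm (?f (n + Suc N)) \<le> of_int B * norm \<alpha> ^ (n + Suc N)"
      using B[of "n + Suc N"] by (auto simp: norm_mult norm_power intro!: mult_right_mono)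
    also have "\<dots> \<le> of_int B * norm \<alpha> ^ (N + n)"
      using norm_less_1 \<open>B \<ge> 0\<close> by (intro mult_left_mono power_decreasing) auto
    finally show "norm (?f (n + Suc N)) \<le> of_int B * norm \<alpha> ^ N * norm \<alpha> ^ n"
      by (simp add: power_add mult_ac)
  next
    show "summable (\<lambda>n. norm (?f (n + Suc N)))" using sum by (subst summable_iff_shift)
    show "summable (\<lambda>n. of_int B * norm \<alpha> ^ N * norm \<alpha> ^ n)"
      using norm_less_1 by (intro summable_mult summable_geometric) simp
  qed
  also have "\<dots> = of_int B / (1 - norm \<alpha>) * norm \<alpha> ^ N"
    using norm_less_1 by (subst suminf_mult) (auto simp: suminf_geometric)
  finally show ?thesis .
qed

text \<open>
  The value of a triple factors as \<open>\<alpha>\<^sup>2 (r\<^sub>k\<^sub>+\<^sub>1 - r\<^sub>k \<alpha> \<beta>)\<close> with the real numbers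
  \<open>r\<^sub>k = u\<^sub>k\<^sub>+\<^sub>1 - |\<alpha>|\<^sup>2 u\<^sub>k\<close>. Because \<open>\<alpha> \<beta>\<close> is not real, the imaginary part of the bracket controls
  \<open>r\<^sub>k\<close>; and \<open>|\<alpha>|\<^sup>2 < 1\<close> makes the recursion \<open>u\<^sub>k\<^sub>+\<^sub>1 = |\<alpha>|\<^sup>2 u\<^sub>k + r\<^sub>k\<close> stable.
\<close>

lemma carry_bounded_if_values_bounded:
  assumes u: "is_carry a l d u"
    and C: "\<And>N. norm (carry_value a \<alpha> (u (l + int N)) (u (l + int N + 1)) (u (l + int N + 2))) \<le> C"
  shows "\<exists>B. \<forall>k. \<bar>u k\<bar> \<le> B"
proof -
  \<comment> \<open>\<open>q\<close> is \<open>1/\<beta>\<close>, the root of \<open>z\<^sup>3 - z\<^sup>2 + a z - 1\<close> inside the unit circle.\<close>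
  define q where "q = (norm \<alpha>)\<^sup>2"
  have q: "of_real q = \<alpha> * cnj \<alpha>" unfolding q_def by (rule complex_norm_square)
  have "0 \<le> q" "q < 1" unfolding q_def using norm_less_1 by (auto simp: power_less_one_iff abs_square_less_1)
  define r where "r k = of_int (u (k + 1)) - q * of_int (u k)" for k
  have small: "u k = 0" if "k \<le> l + 1" for k using u that by (simp add: is_carry_def)
  have factor: "carry_value a \<alpha> x y z =
      \<alpha>\<^sup>2 * (of_real (of_int z - q * of_int y) - of_real (of_int y - q * of_int x) * (\<alpha> * of_real \<beta>))" for x y z
  proof -
    have 1: "1 = \<alpha>\<^sup>2 * ((\<alpha> * cnj \<alpha>) * (\<alpha> * of_real \<beta>)) + \<alpha> - of_int a * \<alpha>\<^sup>2"
    proof -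
      have "\<alpha>\<^sup>2 * ((\<alpha> * cnj \<alpha>) * (\<alpha> * of_real \<beta>)) = \<alpha> ^ 3 * (of_real \<beta> * (\<alpha> * cnj \<alpha>))"
        by (simp add: power2_eq_square power3_eq_cube)
      then show ?thesis by (simp add: vieta_prod alpha_cubed)
    qed
    have 2: "\<alpha> = \<alpha>\<^sup>2 - \<alpha>\<^sup>2 * (\<alpha> * cnj \<alpha> + \<alpha> * of_real \<beta>)"
      using vieta_pairs vieta_prod by algebra
    have "carry_value a \<alpha> x y z = of_int x * (1 - \<alpha> + of_int a * \<alpha>\<^sup>2) + of_int y * (\<alpha> - \<alpha>\<^sup>2) + of_int z * \<alpha>\<^sup>2"
      by (simp add: carry_value_def algebra_simps)
    also have "1 - \<alpha> + of_int a * \<alpha>\<^sup>2 = \<alpha>\<^sup>2 * (of_real q * (\<alpha> * of_real \<beta>))"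
      using 1 q by (simp add: algebra_simps)
    also have "\<alpha> - \<alpha>\<^sup>2 = - (\<alpha>\<^sup>2 * (of_real q + \<alpha> * of_real \<beta>))"
      using 2 q by (simp add: algebra_simps)
    finally show ?thesis by (simp add: algebra_simps)
  qed
  have Im: "Im \<alpha> \<noteq> 0" using not_real by (simp add: complex_is_Real_iff)
  define R where "R = C / ((norm \<alpha>)\<^sup>2 * \<bar>\<beta> * Im \<alpha>\<bar>)"
  have "C \<ge> 0" using C[of 0] norm_ge_zero order_trans by blast
  then have "R \<ge> 0" by (simp add: R_def)
  have r: "\<bar>r k\<bar> \<le> R" if "k \<ge> l" for k
  proof -
    from that obtain N where k: "k = l + int N" using zle_iff_zadd by auto
    let ?w = "of_real (r (k + 1)) - of_real (r k) * (\<alpha> * of_real \<beta>)"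
    have "norm (\<alpha>\<^sup>2 * ?w) \<le> C"
      using C[of N] unfolding factor r_def k by (simp add: algebra_simps)
    then have "(norm \<alpha>)\<^sup>2 * norm ?w \<le> C" by (simp add: norm_mult norm_power)
    moreover have "\<bar>Im ?w\<bar> \<le> norm ?w" by (rule abs_Im_le_cmod)
    moreover have "\<bar>Im ?w\<bar> = \<bar>r k\<bar> * \<bar>\<beta> * Im \<alpha>\<bar>" by (simp add: abs_mult)
    ultimately have "(norm \<alpha>)\<^sup>2 * (\<bar>r k\<bar> * \<bar>\<beta> * Im \<alpha>\<bar>) \<le> C"
      by (metis (no_types, lifting) mult_left_mono order_trans zero_le_power2)
    then show ?thesis using Im beta_nonzero nonzero unfolding R_def
      by (simp add: pos_le_divide_eq mult_ac)
  qed
  define D where "D = R / (1 - q)"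
  have D: "q * D + R = D" "D \<ge> 0" using \<open>q < 1\<close> \<open>R \<ge> 0\<close> by (auto simp: D_def field_simps)
  have "\<bar>of_int (u (l + int n))\<bar> \<le> D" for n
  proof (induction n)
    case 0 then show ?case using small[of l] D by simp
  next
    case (Suc n)
    have "of_int (u (l + int n + 1)) = q * of_int (u (l + int n)) + r (l + int n)"
      by (simp add: r_def)
    also have "\<bar>\<dots>\<bar> \<le> \<bar>q * of_int (u (l + int n))\<bar> + \<bar>r (l + int n)\<bar>" by (rule abs_triangle_ineq)
    also have "\<dots> \<le> q * D + R"
      using Suc r[of "l + int n"] \<open>0 \<le> q\<close> by (intro add_mono) (auto simp: abs_mult mult_left_mono)
    finally show ?case using D by (simp add: algebra_simps)
  qed
  then have "\<bar>of_int (u k)\<bar> \<le> D" for k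
    using small[of k] D zle_iff_zadd[of l k] by (cases "k \<le> l") auto
  then have "\<bar>u k\<bar> \<le> \<lfloor>D\<rfloor>" for k by (simp add: le_floor_iff)
  then show ?thesis by blast
qed

lemma carry_bounded_if_expansions_eq:
  assumes u: "is_carry a l d u" and B: "\<And>k. \<bar>d k\<bar> \<le> B"
    and eq: "(\<Sum>n. of_int (d (l + int n)) * \<alpha> ^ n) = 0"
  shows "\<exists>B. \<forall>k. \<bar>u k\<bar> \<le> B"
proof (rule carry_bounded_if_values_bounded[OF u])
  fix N
  let ?v = "carry_value a \<alpha> (u (l + int N)) (u (l + int N + 1)) (u (l + int N + 2))"
  have "norm \<alpha> ^ N * norm ?v = norm (\<Sum>n\<le>N. of_int (d (l + int n)) * \<alpha> ^ n) * (norm \<alpha>)\<^sup>2"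
    using partial_sum_eq_carry_value[OF u, of N] by (metis norm_mult norm_power)
  also have "\<dots> \<le> of_int B / (1 - norm \<alpha>) * norm \<alpha> ^ N * (norm \<alpha>)\<^sup>2"
    by (intro mult_right_mono partial_sum_bound B eq) simp
  finally have "norm \<alpha> ^ N * norm ?v \<le> norm \<alpha> ^ N * (of_int B / (1 - norm \<alpha>) * (norm \<alpha>)\<^sup>2)"
    by (simp only: mult_ac)
  then show "norm ?v \<le> of_int B / (1 - norm \<alpha>) * (norm \<alpha>)\<^sup>2"
    by (rule mult_left_le_imp_le) (use nonzero in simp)
qed

text \<open>
  The partial sum up to \<open>N\<close> is \<open>\<alpha>\<^sup>N\<^sup>-\<^sup>2\<close> times an element of the finite set of values.
\<close>

lemma expansions_eq_if_values_finite:
  assumes u: "is_carry a l d u" and B: "\<And>k. \<bar>d k\<bar> \<le> B"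
    and fin: "finite (range (\<lambda>N. carry_value a \<alpha> (u (l + int N)) (u (l + int N + 1)) (u (l + int N + 2))))"
  shows "(\<Sum>n. of_int (d (l + int n)) * \<alpha> ^ n) = 0"
proof -
  let ?f = "\<lambda>n. of_int (d (l + int n)) * \<alpha> ^ n"
  let ?v = "\<lambda>N. carry_value a \<alpha> (u (l + int N)) (u (l + int N + 1)) (u (l + int N + 2))"
  have "summable ?f" by (rule summable_norm_cancel, rule power_series_summable) (rule B)
  then have "(\<lambda>N. \<Sum>n\<le>N. ?f n) \<longlonglongrightarrow> suminf ?f" by (rule summable_LIMSEQ')
  moreover have "(\<lambda>N. \<Sum>n\<le>N. ?f n) \<longlonglongrightarrow> 0"
  proof -
    define C where "C = Max (norm ` range ?v)"
    have C: "norm (?v N) \<le> C" for N unfolding C_def using fin by (intro Max_ge) auto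
    have eq: "(\<Sum>n\<le>N. ?f n) = ?v N / \<alpha>\<^sup>2 * \<alpha> ^ N" for N
      using partial_sum_eq_carry_value[OF u, of N] nonzero by (simp add: field_simps)
    have "Bseq (\<lambda>N. ?v N / \<alpha>\<^sup>2)"
      by (rule BseqI'[of _ "C / norm (\<alpha>\<^sup>2)"]) (simp add: norm_divide divide_right_mono C)
    moreover have "Zfun (\<lambda>N. \<alpha> ^ N) sequentially"
      using LIMSEQ_power_zero[OF norm_less_1] by (simp add: tendsto_Zfun_iff)
    ultimately show ?thesis unfolding eq tendsto_Zfun_iff diff_0_right
      by (rule bounded_bilinear.Bfun_prod_Zfun[OF bounded_bilinear_mult])
  qed
  ultimately show ?thesis by (rule LIMSEQ_unique)
qed

end

section \<open>Equality of expansions and finiteness\<close>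

lemma lex_less_iff:
  fixes x y z w a :: int
  assumes "0 \<le> x" "x \<le> a - 1" "0 \<le> y" "y \<le> a - 1" "0 \<le> z" "0 \<le> w"
  shows "[x, y, z, w] <\<^sub>l\<^sub>e\<^sub>x [a - 1, a - 1, 0, 1] \<longleftrightarrow> (x = a - 1 \<and> y = a - 1 \<longrightarrow> z = 0 \<and> w = 0)"
  using assms by (auto simp: lex_less_def)

lemma E_R_digit:
  assumes "s \<in> E_R a" shows "0 \<le> s i" "s i \<le> a - 1"
  using assms by (auto simp: E_R_def R_admissible_def)

text \<open>
  For indices before the first nonzero digit this holds as well, all digits being zero there; so the
  starting index of the sequence need not be carried along.
\<close>

lemma E_R_admissible:
  assumes s: "s \<in> E_R a" and "s i = a - 1" "s (i - 1) = a - 1"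
  shows "s (i - 2) = 0 \<and> s (i - 3) = 0"
proof -
  from s obtain k where zero: "\<forall>i<k. s i = 0" and lex:
    "\<forall>i\<ge>k. [s i, s (i - 1), s (i - 2), s (i - 3)] <\<^sub>l\<^sub>e\<^sub>x [a - 1, a - 1, 0, 1]"
    unfolding E_R_def R_admissible_def by blast
  have "a \<ge> 1" using E_R_digit[OF s, of 0] by linarith
  show ?thesis
  proof (cases "i < k")
    case True
    then show ?thesis using zero by simp
  next
    case False
    then have "[s i, s (i - 1), s (i - 2), s (i - 3)] <\<^sub>l\<^sub>e\<^sub>x [a - 1, a - 1, 0, 1]"
      using lex by simp
    then show ?thesis using assms(2,3) E_R_digit[OF s] by (subst (asm) lex_less_iff) blast+
  qed
qed

text \<open>
  Two zeros after the leading digit make the two extra conditions of \<open>E(G)\<close> hold.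
\<close>

lemma E_GI:
  assumes "a \<ge> 2" and "\<And>i. 0 \<le> s i" "\<And>i. s i \<le> a - 1"
    and "\<And>i. s i = a - 1 \<Longrightarrow> s (i - 1) = a - 1 \<Longrightarrow> s (i - 2) = 0 \<and> s (i - 3) = 0"
    and "s k > 0" "\<And>i. i < k \<Longrightarrow> s i = 0" "s (k + 1) = 0" "s (k + 2) = 0"
  shows "s \<in> E_G a"
proof -
  have "[s i, s (i - 1), s (i - 2), s (i - 3)] <\<^sub>l\<^sub>e\<^sub>x [a - 1, a - 1, 0, 1]" for i
    by (subst lex_less_iff) (use assms in auto)
  then have "R_admissible a k s" using assms by (auto simp: R_admissible_def)
  then show ?thesis unfolding E_G_def
    using assms(1,7,8) assms(3)[of k] by (auto simp: lex_less_def intro!: exI[of _ k])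
qed

lemma E_G_subset_E_R: "E_G a \<subseteq> E_R a"
  by (auto simp: E_G_def E_R_def)

context conjugate_root
begin

lemma bounded_carries_of_digits:
  assumes "a \<ge> 2" "s \<in> E_R a" "t \<in> E_R a" "is_carry a l (\<lambda>k. s k - t k) u"
    and "\<exists>B. \<forall>k. \<bar>u k\<bar> \<le> B"
  shows "bounded_carries a l s t u"
proof
  show "s i \<le> a - 1" "t i \<le> a - 1" for i
    using assms E_R_digit by blast+
qed (use assms in \<open>auto simp: E_R_digit(1) E_R_admissible\<close>)

lemma digit_diff_bound:
  assumes "s \<in> E_R a" "t \<in> E_R a"
  shows "\<bar>s k - t k\<bar> \<le> a"
  using E_R_digit[OF assms(1), of k] E_R_digit[OF assms(2), of k] by linarith

lemma expansion_eq_iff_series_zero: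
  assumes "s \<in> E_R a" "t \<in> E_R a"
  shows "expansion \<alpha> l s = expansion \<alpha> l t \<longleftrightarrow>
    (\<Sum>n. of_int (s (l + int n) - t (l + int n)) * \<alpha> ^ n) = 0"
proof (rule expansion_eq_iff)
  show "\<bar>s k\<bar> \<le> a" "\<bar>t k\<bar> \<le> a" for k
    using E_R_digit[OF assms(1), of k] E_R_digit[OF assms(2), of k] by linarith+
qed

lemma S_set_subset_if_eq:
  assumes a: "a \<ge> 2" and s: "s \<in> seqs_from (E_R a) l" and t: "t \<in> seqs_from (E_R a) l"
    and eq: "expansion \<alpha> l s = expansion \<alpha> l t"
  shows "S_set \<alpha> l s t \<subseteq> S_a a \<alpha>"
proof -
  have st: "s \<in> E_R a" "t \<in> E_R a" using s t by (auto simp: seqs_from_def)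
  obtain u where u: "is_carry a l (\<lambda>k. s k - t k) u"
    using ex_is_carry[of l "\<lambda>k. s k - t k" a] s t by (auto simp: seqs_from_def)
  have "\<exists>B. \<forall>k. \<bar>u k\<bar> \<le> B"
    using carry_bounded_if_expansions_eq[OF u digit_diff_bound[OF st]] eq
    unfolding expansion_eq_iff_series_zero[OF st] by blast
  then interpret bounded_carries a l s t u by (rule bounded_carries_of_digits[OF a st u])
  show ?thesis unfolding S_set_eq_carry_values[OF u] using carry_value_in_S_a by blast
qed

lemma eq_if_S_set_finite:
  assumes s: "s \<in> seqs_from (E_R a) l" and t: "t \<in> seqs_from (E_R a) l"
    and fin: "finite (S_set \<alpha> l s t)"
  shows "expansion \<alpha> l s = expansion \<alpha> l t"
proof -
  have st: "s \<in> E_R a" "t \<in> E_R a" using s t by (auto simp: seqs_from_def)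
  obtain u where u: "is_carry a l (\<lambda>k. s k - t k) u"
    using ex_is_carry[of l "\<lambda>k. s k - t k" a] s t by (auto simp: seqs_from_def)
  show ?thesis unfolding expansion_eq_iff_series_zero[OF st]
    using expansions_eq_if_values_finite[OF u digit_diff_bound[OF st]] fin
    unfolding S_set_eq_carry_values[OF u] by blast
qed

end

section \<open>A pair of sequences that attains every value\<close>

text \<open>
  The values are \<open>\<dots>, 0, 0, 0, 1, 0, -1, 0, 1, 1, 0, -1, -1, 1, 1, -1, -1, 1, 1, \<dots>\<close>, the first \<open>1\<close>
  being at index \<open>2\<close>; up to sign, the consecutive triples are all those of \<open>carry_triple\<close>.
\<close>

definition witness_carry :: "int \<Rightarrow> int" where
  "witness_carry k =
    (if k \<in> {2, 6, 7} then 1 else if k = 4 then -1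
     else if k < 9 then 0 else if k mod 4 \<in> {1, 2} then -1 else 1)"

text \<open>
  The sequences \<open>witness_s\<close> and \<open>witness_t\<close> are the positive and negative parts of the digit
  differences determined by \<open>witness_carry\<close>, with a common digit \<open>1\<close> added at index \<open>-3\<close>. The
  common digit does not change the differences; it makes both sequences start with \<open>1, 0, 0\<close>, which
  puts them into \<open>E(G)\<close> even for \<open>a = 2\<close>.
\<close>

definition witness_s :: "int \<Rightarrow> int \<Rightarrow> int" where
  "witness_s a k =
    (if k \<in> {-3, 0, 5} then 1 else if k \<in> {2, 6} then a - 1 else if k = 7 then a - 2
     else if k \<ge> 11 \<and> k mod 4 \<in> {0, 3} then a - 1 else 0)"

definition witness_t :: "int \<Rightarrow> int \<Rightarrow> int" where
  "witness_t a k =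
    (if k \<in> {-3, 1, 8} then 1 else if k \<in> {4, 10} then a - 1 else if k = 9 then a - 2
     else if k \<ge> 13 \<and> k mod 4 \<in> {1, 2} then a - 1 else 0)"

lemma int_cases_then_mod_4:
  fixes k :: int
  obtains "k < 0" | "k = 0" | "k = 1" | "k = 2" | "k = 3" | "k = 4" | "k = 5" | "k = 6"
    | "k = 7" | "k = 8" | "k = 9" | "k = 10" | "k = 11" | "k = 12" | "k = 13"
    | m where "k = 4 * m + 14" "m \<ge> 0" | m where "k = 4 * m + 15" "m \<ge> 0"
    | m where "k = 4 * m + 16" "m \<ge> 0" | m where "k = 4 * m + 17" "m \<ge> 0"
proof -
  have "\<exists>m\<ge>0. k = 4 * m + 14 \<or> k = 4 * m + 15 \<or> k = 4 * m + 16 \<or> k = 4 * m + 17" if "k \<ge> 14"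
    using that by presburger
  moreover have "k < 0 \<or> k = 0 \<or> k = 1 \<or> k = 2 \<or> k = 3 \<or> k = 4 \<or> k = 5 \<or> k = 6
    \<or> k = 7 \<or> k = 8 \<or> k = 9 \<or> k = 10 \<or> k = 11 \<or> k = 12 \<or> k = 13 \<or> k \<ge> 14" by presburger
  ultimately show thesis using that by blast
qed

lemma witness_is_carry: "is_carry a (-3) (\<lambda>k. witness_s a k - witness_t a k) witness_carry"
proof -
  have "witness_s a k - witness_t a k = witness_carry (k + 2) - witness_carry (k + 1)
    + a * witness_carry k - witness_carry (k - 1)" for k
    by (cases k rule: int_cases_then_mod_4)
      (simp_all add: witness_s_def witness_t_def witness_carry_def)
  then show ?thesis by (simp add: is_carry_def witness_carry_def)
qed

lemma witness_in_E_G: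
  assumes "a \<ge> 2"
  shows "witness_s a \<in> E_G a" "witness_t a \<in> E_G a"
proof -
  have "witness_s a i = a - 1 \<Longrightarrow> witness_s a (i - 1) = a - 1 \<Longrightarrow>
    witness_s a (i - 2) = 0 \<and> witness_s a (i - 3) = 0" for i
    by (cases i rule: int_cases_then_mod_4) (use assms in \<open>auto simp: witness_s_def split: if_splits\<close>)
  then show "witness_s a \<in> E_G a"
    by (intro E_GI[where k = "-3"]) (use assms in \<open>auto simp: witness_s_def\<close>)
  have "witness_t a i = a - 1 \<Longrightarrow> witness_t a (i - 1) = a - 1 \<Longrightarrow>
    witness_t a (i - 2) = 0 \<and> witness_t a (i - 3) = 0" for i
    by (cases i rule: int_cases_then_mod_4) (use assms in \<open>auto simp: witness_t_def split: if_splits\<close>)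
  then show "witness_t a \<in> E_G a"
    by (intro E_GI[where k = "-3"]) (use assms in \<open>auto simp: witness_t_def\<close>)
qed

lemma mem_pmD: "z \<in> pm A \<Longrightarrow> z \<in> A \<or> - z \<in> A"
  by (auto simp: pm_def)

lemma S_set_swap: "S_set \<alpha> l t s = uminus ` S_set \<alpha> l s t"
proof -
  have "\<alpha> powi (- k + 2) * (\<Sum>i=l..k. (of_int (t i) - of_int (s i)) * \<alpha> powi i) =
    - (\<alpha> powi (- k + 2) * (\<Sum>i=l..k. (of_int (s i) - of_int (t i)) * \<alpha> powi i))" for k
    unfolding mult_minus_right[symmetric] sum_negf[symmetric] by (simp add: algebra_simps)
  then show ?thesis unfolding S_set_def setcompr_eq_image image_image by simp
qed

context conjugate_root
begin

lemma S_a_attained: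
  assumes a: "a \<ge> 2" and z: "z \<in> S_a a \<alpha>"
  shows "\<exists>s\<in>seqs_from (E_G a) (-3). \<exists>t\<in>seqs_from (E_G a) (-3).
    expansion \<alpha> (-3) s = expansion \<alpha> (-3) t \<and> z \<in> S_set \<alpha> (-3) s t"
proof -
  let ?s = "witness_s a" and ?t = "witness_t a" and ?w = witness_carry
  let ?cv = "\<lambda>N. carry_value a \<alpha> (?w (-3 + int N)) (?w (-3 + int N + 1)) (?w (-3 + int N + 2))"
  have st: "?s \<in> seqs_from (E_G a) (-3)" "?t \<in> seqs_from (E_G a) (-3)"
    using witness_in_E_G[OF a] by (auto simp: seqs_from_def witness_s_def witness_t_def)
  then have st': "?s \<in> seqs_from (E_R a) (-3)" "?t \<in> seqs_from (E_R a) (-3)"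
    using E_G_subset_E_R by (auto simp: seqs_from_def)
  have S: "S_set \<alpha> (-3) ?s ?t = range ?cv"
    by (rule S_set_eq_carry_values[OF witness_is_carry])
  have w: "?w k \<in> {-1, 0, 1}" for k by (auto simp: witness_carry_def)
  have "S_set \<alpha> (-3) ?s ?t \<subseteq> (\<lambda>(x, y, z). carry_value a \<alpha> x y z) ` ({-1,0,1} \<times> {-1,0,1} \<times> {-1,0,1})"
  proof -
    have "?cv N \<in> (\<lambda>(x, y, z). carry_value a \<alpha> x y z) ` ({-1,0,1} \<times> {-1,0,1} \<times> {-1,0,1})" for N
      by (rule image_eqI[where x = "(?w (-3 + int N), ?w (-3 + int N + 1), ?w (-3 + int N + 2))"])
        (simp_all only: mem_Times_iff fst_conv snd_conv w case_prod_conv simp_thms)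
    then show ?thesis unfolding S by blast
  qed
  then have "finite (S_set \<alpha> (-3) ?s ?t)" by (rule finite_subset) simp
  then have eq: "expansion \<alpha> (-3) ?s = expansion \<alpha> (-3) ?t"
    by (rule eq_if_S_set_finite[OF st'])
  have vals: "?cv 0 = 0" "?cv 3 = \<alpha>\<^sup>2" "?cv 4 = \<alpha> - \<alpha>\<^sup>2" "?cv 8 = \<alpha>"
    "?cv 9 = 1 + (of_int a - 1) * \<alpha>\<^sup>2" "?cv 10 = 1 - \<alpha> + (of_int a - 1) * \<alpha>\<^sup>2"
    "?cv 14 = 1 + (of_int a - 2) * \<alpha>\<^sup>2" "?cv 15 = 1 - 2 * \<alpha> + of_int a * \<alpha>\<^sup>2"
    by (simp_all add: witness_carry_def carry_value_def algebra_simps)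
  let ?base = "{0, \<alpha>, \<alpha>^2, \<alpha> - \<alpha>^2,
    1 + (of_int a - 1) * \<alpha>^2, 1 + (of_int a - 2) * \<alpha>^2,
    1 - \<alpha> + (of_int a - 1) * \<alpha>^2, 1 - 2 * \<alpha> + of_int a * \<alpha>^2}"
  have base: "?base \<subseteq> range ?cv"
    by (intro insert_subsetI empty_subsetI; rule range_eqI, rule vals[symmetric])
  have "z \<in> ?base \<or> - z \<in> ?base"
    using mem_pmD[OF z[unfolded S_a_def]] .
  then have "z \<in> range ?cv \<or> - z \<in> range ?cv"
    by (rule disj_forward) (erule subsetD[OF base])+
  then show ?thesis
  proof
    assume "z \<in> range ?cv"
    then have "z \<in> S_set \<alpha> (-3) ?s ?t" unfolding S .
    then show ?thesis by (intro bexI[of _ ?s] bexI[of _ ?t] conjI eq st)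
  next
    assume "- z \<in> range ?cv"
    then have "z \<in> S_set \<alpha> (-3) ?t ?s" unfolding S_set_swap[of \<alpha> "-3" ?t] S
      by (intro image_eqI[where x = "- z"]) simp_all
    then show ?thesis by (intro bexI[of _ ?t] bexI[of _ ?s] conjI eq[symmetric] st)
  qed
qed

end

section \<open>The characterisation\<close>

text \<open>
  Evaluating the factorisation at \<open>0\<close>, \<open>1\<close> and \<open>-1\<close> gives Vieta's formulas.
\<close>

lemma conjugate_root_from_factorisation:
  fixes a :: int and \<alpha> :: complex and \<beta> :: real
  assumes fact: "\<forall>x::complex. x^3 - of_int a * x^2 + x - 1 = (x - of_real \<beta>) * (x - \<alpha>) * (x - cnj \<alpha>)"
    and "\<alpha> \<notin> \<real>" "norm \<alpha> < 1"
  shows "conjugate_root a \<alpha> \<beta>"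
proof
  let ?b = "of_real \<beta> :: complex"
  have 0: "?b * (\<alpha> * cnj \<alpha>) = 1"
    using spec[OF fact, of 0] by (simp add: mult_ac)
  have 1: "- of_int a = - (\<alpha> + cnj \<alpha> + ?b) + (\<alpha> * cnj \<alpha> + ?b * (\<alpha> + cnj \<alpha>)) - ?b * (\<alpha> * cnj \<alpha>)"
    using spec[OF fact, of 1] by (simp add: algebra_simps)
  have 2: "- 3 - of_int a = - 1 - (\<alpha> + cnj \<alpha> + ?b) - (\<alpha> * cnj \<alpha> + ?b * (\<alpha> + cnj \<alpha>)) - ?b * (\<alpha> * cnj \<alpha>)"
    using spec[OF fact, of "-1"] by (simp add: algebra_simps)
  show "?b * (\<alpha> * cnj \<alpha>) = 1" by (fact 0)
  show "\<alpha> + cnj \<alpha> + ?b = of_int a" "\<alpha> * cnj \<alpha> + ?b * (\<alpha> + cnj \<alpha>) = 1"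
    using 0 1 2 by algebra+
qed (fact assms)+

theorem theorem4p2:
  fixes a :: int and \<beta> :: real and \<alpha> \<gamma> :: complex and X :: "(int \<Rightarrow> int) set"
  assumes "a \<ge> 2"
    and "\<forall>x::complex. x^3 - of_int a * x^2 + x - 1 = (x - of_real \<beta>) * (x - \<alpha>) * (x - \<gamma>)"
    and "\<beta> > 1" and "\<alpha> \<notin> \<real>" and "\<gamma> \<notin> \<real>" and "\<gamma> = cnj \<alpha>" and "norm \<alpha> < 1"
    and "X = E_R a \<or> X = E_G a"
  shows "(\<forall>l. \<forall>\<epsilon>\<in>seqs_from X l. \<forall>\<epsilon>'\<in>seqs_from X l.
            (expansion \<alpha> l \<epsilon> = expansion \<alpha> l \<epsilon>' \<longleftrightarrow> finite (S_set \<alpha> l \<epsilon> \<epsilon>')) \<and>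
            (expansion \<alpha> l \<epsilon> = expansion \<alpha> l \<epsilon>' \<longrightarrow> S_set \<alpha> l \<epsilon> \<epsilon>' \<subseteq> S_a a \<alpha>))
       \<and> S_a a \<alpha> = (\<Union>(l, \<epsilon>, \<epsilon>')\<in>Delta \<alpha> X. S_set \<alpha> l \<epsilon> \<epsilon>')"
proof -
  interpret conjugate_root a \<alpha> \<beta>
    using assms(2) unfolding \<open>\<gamma> = cnj \<alpha>\<close>
    by (rule conjugate_root_from_factorisation) fact+
  have sub: "seqs_from X l \<subseteq> seqs_from (E_R a) l" and sup: "seqs_from (E_G a) l \<subseteq> seqs_from X l" for l
    using assms(8) E_G_subset_E_R by (auto simp: seqs_from_def)
  have fin: "finite (S_a a \<alpha>)" by (simp add: S_a_def pm_def)
  have subset: "S_set \<alpha> l s t \<subseteq> S_a a \<alpha>"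
    if "s \<in> seqs_from X l" "t \<in> seqs_from X l" "expansion \<alpha> l s = expansion \<alpha> l t" for l s t
    using S_set_subset_if_eq[OF assms(1) _ _ that(3)] that sub by blast
  have eq: "expansion \<alpha> l s = expansion \<alpha> l t"
    if "s \<in> seqs_from X l" "t \<in> seqs_from X l" "finite (S_set \<alpha> l s t)" for l s t
    using eq_if_S_set_finite[OF _ _ that(3)] that sub by blast
  have "S_a a \<alpha> = (\<Union>(l, \<epsilon>, \<epsilon>')\<in>Delta \<alpha> X. S_set \<alpha> l \<epsilon> \<epsilon>')"
  proof
    show "(\<Union>(l, \<epsilon>, \<epsilon>')\<in>Delta \<alpha> X. S_set \<alpha> l \<epsilon> \<epsilon>') \<subseteq> S_a a \<alpha>"
      using subset by (auto simp: Delta_def)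
    show "S_a a \<alpha> \<subseteq> (\<Union>(l, \<epsilon>, \<epsilon>')\<in>Delta \<alpha> X. S_set \<alpha> l \<epsilon> \<epsilon>')"
    proof
      fix z assume "z \<in> S_a a \<alpha>"
      from S_a_attained[OF assms(1) this] obtain s t where
        "s \<in> seqs_from (E_G a) (-3)" "t \<in> seqs_from (E_G a) (-3)"
        "expansion \<alpha> (-3) s = expansion \<alpha> (-3) t" and z: "z \<in> S_set \<alpha> (-3) s t" by blast
      then have "(-3, s, t) \<in> Delta \<alpha> X" using sup by (auto simp: Delta_def)
      then show "z \<in> (\<Union>(l, \<epsilon>, \<epsilon>')\<in>Delta \<alpha> X. S_set \<alpha> l \<epsilon> \<epsilon>')" using z by blast
    qed
  qed
  moreover have "expansion \<alpha> l s = expansion \<alpha> l t \<longleftrightarrow> finite (S_set \<alpha> l s t)"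
    if "s \<in> seqs_from X l" "t \<in> seqs_from X l" for l s t
    using finite_subset[OF subset[OF that] fin] eq[OF that] by iprover
  ultimately show ?thesis by (intro conjI ballI allI impI subset)
qed

end
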